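(* Let $(\mathcal{V},\circ,\langle\cdot,\cdot\rangle)$ be a Euclidean Jordan algebra of rank $n$ and let $a,b\in\mathcal{V}$. Then $$\lambda\big(|a\circ b|\big)\underset{w}{\prec}\lambda(|a|)*\lambda(|b|).$$
   Context: A Euclidean Jordan algebra $(\mathcal{V},\circ,\langle\cdot,\cdot\rangle)$ is a finite-dimensional real inner product space with a commutative bilinear product $\circ$ satisfying $x\circ(x^2\circ y)=x^2\circ(x\circ y)$ and $\langle x\circ y,z\rangle=\langle y,x\circ z\rangle$ (where $x^2=x\circ x$), with unit element $e$. A Jordan frame is a set $\{e_1,\dots,e_n\}$ of primitive idempotents with $e_i\circ e_j=0$ for $i\neq j$ and $\sum_i e_i=e$; the number $n$ is the rank of $\mathcal{V}$. Every $x\in\mathcal{V}$ has a spectral decomposition $x=x_1e_1+\cdots+x_ne_n$ for some Jordan frame $\{e_1,\dots,e_n\}$, with the real numbers $x_i$ (the eigenvalues of $x$) uniquely determined up to order. $\lambda(x)\in\mathbb{R}^n$ denotes the vector of eigenvalues of $x$ in decreasing order, and $|x|:=\sum_i|x_i|e_i$. The inner product is the trace inner product $\langle x,y\rangle=\operatorname{tr}(x\circ y)$, where $\operatorname{tr}$ is the sum of eigenvalues. For $p,q\in\mathbb{R}^n$, $p*q$ is the componentwise product and $p^\downarrow$ the decreasing rearrangement of $p$. $p\underset{w}{\prec}q$ means $\sum_{i=1}^k p_i^\downarrow\leq\sum_{i=1}^k q_i^\downarrow$ for all $1\leq k\leq n$. *)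

theory Defs
  imports "HOL-Analysis.Analysis"
begin

locale euclidean_jordan_algebra =
  fixes jprod :: "'a::euclidean_space \<Rightarrow> 'a \<Rightarrow> 'a"  (infixl "\<odot>" 70)
    and e :: 'a
  assumes bilinear: "bilinear (\<odot>)"
    and commute: "x \<odot> y = y \<odot> x"
    and jordan_identity: "x \<odot> ((x \<odot> x) \<odot> y) = (x \<odot> x) \<odot> (x \<odot> y)"
    and inner_assoc: "inner (x \<odot> y) z = inner y (x \<odot> z)"
    and unit: "e \<odot> x = x"

definition idempotent :: "('a \<Rightarrow> 'a \<Rightarrow> 'a) \<Rightarrow> 'a \<Rightarrow> bool" where
  "idempotent jprod c \<longleftrightarrow> jprod c c = c"

text \<open>
  The two summands in the next definition are automatically orthogonal: if \<open>u\<close>, \<open>v\<close> and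
  \<open>u + v\<close> are idempotent, then expanding the square of \<open>u + v\<close> gives \<open>jprod u v = 0\<close>.
\<close>

definition primitive_idempotent ::
    "('a::real_vector \<Rightarrow> 'a \<Rightarrow> 'a) \<Rightarrow> 'a \<Rightarrow> bool" where
  "primitive_idempotent jprod c \<longleftrightarrow>
     idempotent jprod c \<and> c \<noteq> 0 \<and>
     (\<nexists>u v. idempotent jprod u \<and> idempotent jprod v \<and> u \<noteq> 0 \<and> v \<noteq> 0 \<and> c = u + v)"

definition jordan_frame ::
    "('a::real_vector \<Rightarrow> 'a \<Rightarrow> 'a) \<Rightarrow> 'a \<Rightarrow> 'a set \<Rightarrow> bool" where
  "jordan_frame jprod e F \<longleftrightarrow>
     finite F \<and>
     (\<forall>c\<in>F. primitive_idempotent jprod c) \<and>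
     (\<forall>c\<in>F. \<forall>d\<in>F. c \<noteq> d \<longrightarrow> jprod c d = 0) \<and>
     \<Sum>F = e"

text \<open>
  In a Euclidean Jordan algebra all Jordan frames have the same cardinality.
\<close>

definition jordan_rank :: "('a::real_vector \<Rightarrow> 'a \<Rightarrow> 'a) \<Rightarrow> 'a \<Rightarrow> nat" where
  "jordan_rank jprod e = (THE n. \<exists>F. jordan_frame jprod e F \<and> card F = n)"

text \<open>
  The frame is enumerated as a list \<open>es\<close> and \<open>xs\<close> lists the corresponding coefficients,
  in any order. Vectors in \<open>\<real>\<^sup>n\<close> are represented as real lists of length \<open>n\<close>.
\<close>

definition spectral_decomposition ::
    "('a::real_vector \<Rightarrow> 'a \<Rightarrow> 'a) \<Rightarrow> 'a \<Rightarrow> 'a \<Rightarrow> 'a list \<Rightarrow> real list \<Rightarrow> bool" where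
  "spectral_decomposition jprod e x es xs \<longleftrightarrow>
     distinct es \<and> jordan_frame jprod e (set es) \<and> length xs = length es \<and>
     x = (\<Sum>i<length es. xs ! i *\<^sub>R es ! i)"

text \<open>
  In a Euclidean Jordan algebra every element has a spectral decomposition, and neither its
  decreasingly ordered eigenvalues nor its absolute value depend on the one chosen, so both
  descriptions below are proper.
\<close>

definition eigenvalues ::
    "('a::real_vector \<Rightarrow> 'a \<Rightarrow> 'a) \<Rightarrow> 'a \<Rightarrow> 'a \<Rightarrow> real list" where
  "eigenvalues jprod e x =
     (THE xs. sorted_wrt (\<ge>) xs \<and> (\<exists>es. spectral_decomposition jprod e x es xs))"

definition jordan_trace :: "('a::real_vector \<Rightarrow> 'a \<Rightarrow> 'a) \<Rightarrow> 'a \<Rightarrow> 'a \<Rightarrow> real" where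
  "jordan_trace jprod e x = sum_list (eigenvalues jprod e x)"

definition jordan_abs :: "('a::real_vector \<Rightarrow> 'a \<Rightarrow> 'a) \<Rightarrow> 'a \<Rightarrow> 'a \<Rightarrow> 'a" where
  "jordan_abs jprod e x =
     (THE y. \<exists>es xs. spectral_decomposition jprod e x es xs \<and>
                     y = (\<Sum>i<length es. \<bar>xs ! i\<bar> *\<^sub>R es ! i))"

definition componentwise_prod :: "real list \<Rightarrow> real list \<Rightarrow> real list" where
  "componentwise_prod p q = map2 (*) p q"

definition decreasing_rearrangement :: "real list \<Rightarrow> real list" where
  "decreasing_rearrangement p = rev (sort p)"

text \<open>
  The length conditions say that \<open>p\<close> and \<open>q\<close> are vectors in \<open>\<real>\<^sup>n\<close>.
\<close>

definition weakly_majorized :: "nat \<Rightarrow> real list \<Rightarrow> real list \<Rightarrow> bool" where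
  "weakly_majorized n p q \<longleftrightarrow>
     length p = n \<and> length q = n \<and>
     (\<forall>k\<in>{1..n}. (\<Sum>i<k. decreasing_rearrangement p ! i)
                  \<le> (\<Sum>i<k. decreasing_rearrangement q ! i))"

end

theory Submission
  imports Defs
begin

text \<open>
  The sum of the \<open>k\<close> largest absolute eigenvalues of \<open>a \<odot> b\<close> is the value at \<open>(a, b, u)\<close> of the
  symmetric trilinear form \<open>\<langle>x \<odot> y, z\<rangle>\<close>, where \<open>u\<close> is a sum of \<open>k\<close> signed members of a Jordan
  frame. Writing \<open>a\<close> and \<open>b\<close>, by summation by parts, as nonnegative combinations of signed partial
  sums \<open>s\<^sub>j\<close>, \<open>t\<^sub>l\<close> of their frames, one is reduced to \<open>\<langle>s\<^sub>j \<odot> t\<^sub>l, u\<rangle> \<le> min j (min l k)\<close>. By symmetry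
  this follows from \<open>\<bar>\<langle>c, t \<odot> u\<rangle>\<bar> \<le> 1\<close> for a primitive idempotent \<open>c\<close>, and that bound holds
  because \<open>\<langle>c, x \<odot> x\<rangle> \<ge> 0\<close>.

  The uniqueness of eigenvalues is immediate for elements whose coefficients in some frame are
  distinct. For these the trace form gives \<open>\<langle>x, e\<rangle> = \<Sum>\<^sub>i x\<^sub>i\<close>, and varying the coefficients
  yields \<open>\<langle>c, e\<rangle> = 1\<close> for every member \<open>c\<close> of a frame. Hence the rank is \<open>\<langle>e, e\<rangle>\<close>, and the
  multiplicity of an eigenvalue is the inner product of its eigenidempotent with \<open>e\<close>.
\<close>

section \<open>Spectral theorem for self-adjoint maps on an invariant subspace\<close>

lemma self_adjoint_eigenvector:
  fixes T :: "'a::euclidean_space \<Rightarrow> 'a"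
  assumes lin: "linear T" and sa: "\<And>x y. inner (T x) y = inner x (T y)"
    and S: "subspace S" and inv: "\<And>x. x \<in> S \<Longrightarrow> T x \<in> S" and nz: "w \<in> S" "w \<noteq> 0"
  obtains v \<mu> where "v \<in> S" "v \<noteq> 0" "T v = \<mu> *\<^sub>R v"
proof -
  have comp: "compact (S \<inter> sphere 0 1)"
    using S by (simp add: closed_subspace closed_Int_compact)
  have "(1 / norm w) *\<^sub>R w \<in> S \<inter> sphere 0 1"
    using S nz by (simp add: subspace_scale)
  then have ne: "S \<inter> sphere 0 1 \<noteq> {}" by blast
  have cont: "continuous_on (S \<inter> sphere 0 1) (\<lambda>x. inner (T x) x)"
    using lin by (intro continuous_intros linear_continuous_on linear_conv_bounded_linear[THEN iffD1])
  obtain v where v: "v \<in> S" "norm v = 1"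
    and vmax: "\<And>x. x \<in> S \<Longrightarrow> norm x = 1 \<Longrightarrow> inner (T x) x \<le> inner (T v) v"
    using continuous_attains_sup[OF comp ne cont] by auto
  define \<mu> where "\<mu> = inner (T v) v"
  \<comment> \<open>Scaling turns the maximum over the unit sphere into nonnegativity of the form
    \<open>\<mu> * inner x x - inner (T x) x\<close> on all of \<open>S\<close>.\<close>
  have le: "inner (T x) x \<le> \<mu> * inner x x" if "x \<in> S" for x
  proof (cases "x = 0")
    case True
    then show ?thesis using lin by (simp add: linear_0)
  next
    case False
    have "inner (T ((1 / norm x) *\<^sub>R x)) ((1 / norm x) *\<^sub>R x) \<le> \<mu>"
      unfolding \<mu>_def using that False S by (intro vmax) (simp_all add: subspace_scale)
    then have "inner (T x) x / (norm x * norm x) \<le> \<mu>"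
      using lin by (simp add: linear_scale field_simps)
    then show ?thesis
      using False by (simp add: dot_square_norm power2_eq_square pos_divide_le_eq)
  qed
  \<comment> \<open>The residual \<open>r\<close> is minus half the gradient of the Rayleigh form
    along the sphere. Moving from the maximiser in direction \<open>r\<close> leaves a polynomial in
    \<open>t\<close> without constant term.\<close>
  define r where "r = \<mu> *\<^sub>R v - T v"
  have rS: "r \<in> S"
    unfolding r_def using S v inv by (simp add: subspace_diff subspace_scale)
  have q: "0 \<le> 2 * t * inner r r + t\<^sup>2 * (\<mu> * inner r r - inner (T r) r)" for t :: real
  proof -
    have "v + t *\<^sub>R r \<in> S" using S v rS by (simp add: subspace_add subspace_scale)
    from le[OF this] have "0 \<le> \<mu> * inner (v + t *\<^sub>R r) (v + t *\<^sub>R r) - inner (T (v + t *\<^sub>R r)) (v + t *\<^sub>R r)"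
      by simp
    also have "\<dots> = (\<mu> * inner v v - inner (T v) v) + 2 * t * (\<mu> * inner v r - inner (T v) r)
        + t\<^sup>2 * (\<mu> * inner r r - inner (T r) r)"
      using sa[of r v]
      by (simp add: linear_add[OF lin] linear_scale[OF lin] algebra_simps power2_eq_square inner_commute)
    also have "\<mu> * inner v v - inner (T v) v = 0"
      using v by (simp add: \<mu>_def dot_square_norm)
    also have "\<mu> * inner v r - inner (T v) r = inner r r"
      by (simp add: r_def inner_diff_left)
    finally show ?thesis by simp
  qed
  have "r = 0"
  proof (rule ccontr)
    assume "r \<noteq> 0"
    then have pos: "inner r r > 0" by simp
    \<comment> \<open>\<open>A\<close> dominates the quadratic coefficient, and the added 1 keeps it
      positive. At this \<open>t\<close> the linear term wins, giving
      \<open>- (inner r r)\<^sup>2 / A\<close>.\<close>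
    define A where "A = \<bar>\<mu> * inner r r - inner (T r) r\<bar> + 1"
    define t where "t = - inner r r / A"
    have "A > 0" by (simp add: A_def add_nonneg_pos)
    have "2 * t * inner r r + t\<^sup>2 * (\<mu> * inner r r - inner (T r) r) \<le> 2 * t * inner r r + t\<^sup>2 * A"
      by (intro add_left_mono mult_left_mono) (auto simp: A_def)
    also have "\<dots> = - (inner r r)\<^sup>2 / A"
      using \<open>A > 0\<close> by (simp add: t_def field_simps power2_eq_square)
    also have "\<dots> < 0" using pos \<open>A > 0\<close> by simp
    finally show False using q[of t] by simp
  qed
  then have "T v = \<mu> *\<^sub>R v" by (simp add: r_def)
  with v show ?thesis using that[of v \<mu>] by fastforce
qed

text \<open>Induction on the dimension: self-adjointness makes the orthogonal complement of an
  eigenvector inside \<open>S\<close> invariant again.\<close>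

lemma self_adjoint_eigenbasis:
  fixes T :: "'a::euclidean_space \<Rightarrow> 'a"
  assumes lin: "linear T" and sa: "\<And>x y. inner (T x) y = inner x (T y)"
    and S: "subspace S" and inv: "\<And>x. x \<in> S \<Longrightarrow> T x \<in> S"
  shows "\<exists>B. finite B \<and> 0 \<notin> B \<and> B \<subseteq> S \<and> span B = S \<and> pairwise orthogonal B
           \<and> (\<forall>v\<in>B. \<exists>\<mu>. T v = \<mu> *\<^sub>R v)"
  using S inv
proof (induction "dim S" arbitrary: S rule: less_induct)
  case less
  show ?case
  proof (cases "S = {0}")
    case True
    then show ?thesis by (intro exI[of _ "{}"]) simp
  next
    case False
    then obtain w where "w \<in> S" "w \<noteq> 0" using less.prems(1) subspace_0 by blast
    then obtain v \<mu> where v: "v \<in> S" "v \<noteq> 0" "T v = \<mu> *\<^sub>R v"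
      using self_adjoint_eigenvector[OF lin sa less.prems] by metis
    define S' where "S' = {x \<in> S. inner v x = 0}"
    have S': "subspace S'"
      using less.prems(1) by (auto simp: S'_def subspace_def inner_add_right)
    have inv': "T x \<in> S'" if "x \<in> S'" for x
      using that less.prems(2) sa[of v x] v(3) by (auto simp: S'_def)
    have "v \<notin> S'" using v by (simp add: S'_def)
    then have "S' \<subset> S" using v(1) by (auto simp only: S'_def)
    then have "dim S' < dim S"
      using S' less.prems(1) by (metis dim_psubset span_eq_iff)
    then obtain B where B: "finite B" "0 \<notin> B" "B \<subseteq> S'" "span B = S'" "pairwise orthogonal B"
        "\<forall>v\<in>B. \<exists>\<mu>. T v = \<mu> *\<^sub>R v"
      using less.hyps[OF _ S' inv'] by auto
    have "x \<in> span (insert v B)" if "x \<in> S" for x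
    proof -
      have "x - (inner v x / inner v v) *\<^sub>R v \<in> span B"
        unfolding B(4) S'_def using that v less.prems(1)
        by (simp add: subspace_diff subspace_scale inner_diff_right)
      then show ?thesis using span_breakdown_eq by blast
    qed
    moreover have "span (insert v B) \<subseteq> S"
      using B(3) v less.prems(1) by (intro span_minimal) (auto simp: S'_def)
    moreover have "pairwise orthogonal (insert v B)"
      using B(3,5) by (auto simp: pairwise_insert S'_def orthogonal_def inner_commute)
    ultimately show ?thesis
      using B v by (intro exI[of _ "insert v B"]) (auto simp: S'_def)
  qed
qed

section \<open>Bilinearity and polarizations of the Jordan identity\<close>

context euclidean_jordan_algebra
begin

lemma linear_jprod: "linear (\<lambda>y. x \<odot> y)"
  using bilinear by (simp add: bilinear_def)

lemma jprod_simps: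
  "(x + y) \<odot> z = x \<odot> z + y \<odot> z" "x \<odot> (y + z) = x \<odot> y + x \<odot> z"
  "(x - y) \<odot> z = x \<odot> z - y \<odot> z" "x \<odot> (y - z) = x \<odot> y - x \<odot> z"
  "(r *\<^sub>R x) \<odot> y = r *\<^sub>R (x \<odot> y)" "x \<odot> (r *\<^sub>R y) = r *\<^sub>R (x \<odot> y)"
  "0 \<odot> x = 0" "x \<odot> 0 = 0"
  using bilinear
  by (simp_all add: bilinear_ladd bilinear_radd bilinear_lsub bilinear_rsub
      bilinear_lmul bilinear_rmul bilinear_lzero bilinear_rzero)

lemma jprod_sum_right: "x \<odot> (\<Sum>i\<in>I. f i) = (\<Sum>i\<in>I. x \<odot> f i)"
  by (rule linear_sum[OF linear_jprod])

lemma jprod_sum_left: "(\<Sum>i\<in>I. f i) \<odot> x = (\<Sum>i\<in>I. f i \<odot> x)"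
  using jprod_sum_right[of x f I] by (simp only: commute[of _ x])

lemma unit_right: "x \<odot> e = x"
  using unit commute by metis

lemma inner_unit: "inner (x \<odot> y) e = inner x y"
  by (metis inner_assoc unit_right inner_commute)

lemma inner_jprod_swap: "inner (x \<odot> y) z = inner x (y \<odot> z)"
  by (metis inner_assoc commute)

text \<open>Subtracting the Jordan identity at \<open>x - y\<close> from that at
  \<open>x + y\<close> leaves the parts odd in \<open>y\<close>; the instance at \<open>y\<close>
  removes the cubic one. Pairing with a test vector turns this into real linear arithmetic.\<close>

lemma linearized_jordan_identity:
  "y \<odot> ((x \<odot> x) \<odot> w) + 2 *\<^sub>R (x \<odot> ((x \<odot> y) \<odot> w)) = (x \<odot> x) \<odot> (y \<odot> w) + 2 *\<^sub>R ((x \<odot> y) \<odot> (x \<odot> w))"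
proof (rule vector_eq_rdot[THEN iffD1], rule allI)
  fix z
  note j = jordan_identity[THEN arg_cong, where f = "\<lambda>v. inner v z"]
  show "inner (y \<odot> ((x \<odot> x) \<odot> w) + 2 *\<^sub>R (x \<odot> ((x \<odot> y) \<odot> w))) z
    = inner ((x \<odot> x) \<odot> (y \<odot> w) + 2 *\<^sub>R ((x \<odot> y) \<odot> (x \<odot> w))) z"
    using j[of "x + y" w] j[of "x - y" w] j[of x w] j[of y w]
    by (simp add: jprod_simps inner_add_left inner_diff_left commute[of y x])
qed

lemma fully_linearized_jordan_identity:
  "y \<odot> ((x \<odot> z) \<odot> w) + x \<odot> ((z \<odot> y) \<odot> w) + z \<odot> ((x \<odot> y) \<odot> w)
    = (x \<odot> z) \<odot> (y \<odot> w) + (z \<odot> y) \<odot> (x \<odot> w) + (x \<odot> y) \<odot> (z \<odot> w)"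
proof (rule vector_eq_rdot[THEN iffD1], rule allI)
  fix q
  note j = linearized_jordan_identity[THEN arg_cong, where f = "\<lambda>v. inner v q"]
  show "inner (y \<odot> ((x \<odot> z) \<odot> w) + x \<odot> ((z \<odot> y) \<odot> w) + z \<odot> ((x \<odot> y) \<odot> w)) q
    = inner ((x \<odot> z) \<odot> (y \<odot> w) + (z \<odot> y) \<odot> (x \<odot> w) + (x \<odot> y) \<odot> (z \<odot> w)) q"
    using j[of y "x + z" w] j[of y x w] j[of y z w]
    by (simp add: jprod_simps inner_add_left inner_diff_left commute[of z x])
qed

text \<open>The full linearization, solved for multiplication by a triple product as an operator on
  \<open>y\<close>. This supplies the recursion for multiplications by powers.\<close>

lemma jprod_triple:
  "((x \<odot> z) \<odot> w) \<odot> y = (x \<odot> z) \<odot> (w \<odot> y) + (x \<odot> w) \<odot> (z \<odot> y) + (z \<odot> w) \<odot> (x \<odot> y)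
    - x \<odot> (w \<odot> (z \<odot> y)) - z \<odot> (w \<odot> (x \<odot> y))"
proof -
  have "y \<odot> ((x \<odot> z) \<odot> w) = ((x \<odot> z) \<odot> w) \<odot> y" "x \<odot> ((z \<odot> y) \<odot> w) = x \<odot> (w \<odot> (z \<odot> y))"
    "z \<odot> ((x \<odot> y) \<odot> w) = z \<odot> (w \<odot> (x \<odot> y))" "(x \<odot> z) \<odot> (y \<odot> w) = (x \<odot> z) \<odot> (w \<odot> y)"
    "(z \<odot> y) \<odot> (x \<odot> w) = (x \<odot> w) \<odot> (z \<odot> y)" "(x \<odot> y) \<odot> (z \<odot> w) = (z \<odot> w) \<odot> (x \<odot> y)"
    by (metis commute)+
  with fully_linearized_jordan_identity[of y x z w] show ?thesis
    by (simp add: eq_diff_eq add_ac)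
qed

section \<open>Power associativity\<close>

primrec jpow :: "'a \<Rightarrow> nat \<Rightarrow> 'a" where
  "jpow x 0 = e"
| "jpow x (Suc k) = x \<odot> jpow x k"

text \<open>By \<open>jprod_triple\<close>, multiplication by \<open>x^(k+2)\<close> is a polynomial in the multiplications by
  \<open>x\<close>, \<open>x\<^sup>2\<close>, \<open>x^k\<close> and \<open>x^(k+1)\<close>; hence the induction over two consecutive exponents.\<close>

lemma jpow_commute:
  "(\<forall>y. jpow x k \<odot> (x \<odot> y) = x \<odot> (jpow x k \<odot> y) \<and>
        jpow x k \<odot> ((x \<odot> x) \<odot> y) = (x \<odot> x) \<odot> (jpow x k \<odot> y)) \<and>
   (\<forall>y. jpow x (Suc k) \<odot> (x \<odot> y) = x \<odot> (jpow x (Suc k) \<odot> y) \<and>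
        jpow x (Suc k) \<odot> ((x \<odot> x) \<odot> y) = (x \<odot> x) \<odot> (jpow x (Suc k) \<odot> y))"
proof (induction k)
  case 0
  then show ?case by (simp add: unit unit_right jordan_identity)
next
  case (Suc k)
  let ?p = "jpow x k" and ?q = "jpow x (Suc k)"
  have *: "jpow x (Suc (Suc k)) \<odot> y = 2 *\<^sub>R (?q \<odot> (x \<odot> y)) + (x \<odot> x) \<odot> (?p \<odot> y)
      - x \<odot> (x \<odot> (?p \<odot> y)) - ?p \<odot> (x \<odot> (x \<odot> y))" for y
    using jprod_triple[of x "jpow x k" x y]
    by (simp add: commute[of "x \<odot> jpow x k" x] commute[of "jpow x k" x] scaleR_2)
  have "jpow x (Suc (Suc k)) \<odot> (x \<odot> y) = x \<odot> (jpow x (Suc (Suc k)) \<odot> y) \<and>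
        jpow x (Suc (Suc k)) \<odot> ((x \<odot> x) \<odot> y) = (x \<odot> x) \<odot> (jpow x (Suc (Suc k)) \<odot> y)" for y
    unfolding * using Suc by (simp add: jprod_simps jordan_identity del: jpow.simps)
  with Suc show ?case by blast
qed

lemma jpow_add: "jpow x m \<odot> jpow x k = jpow x (m + k)"
proof (induction k)
  case 0
  then show ?case by (simp add: unit_right)
next
  case (Suc k)
  have "jpow x m \<odot> (x \<odot> jpow x k) = x \<odot> (jpow x m \<odot> jpow x k)"
    using jpow_commute[of x m] by blast
  with Suc show ?case by simp
qed

section \<open>Peirce spectrum of an idempotent and positivity\<close>

lemma peirce_identity:
  assumes "idempotent (\<odot>) c"
  shows "c \<odot> x + 2 *\<^sub>R (c \<odot> (c \<odot> (c \<odot> x))) = 3 *\<^sub>R (c \<odot> (c \<odot> x))"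
proof -
  have cc: "c \<odot> c = c" using assms by (simp add: idempotent_def)
  have "3 *\<^sub>R (c \<odot> (c \<odot> x)) = c \<odot> (c \<odot> x) + 2 *\<^sub>R (c \<odot> (c \<odot> x))"
    by (metis scaleR_add_left scaleR_one one_add_one numeral_Bit1 numeral_One add.commute)
  \<comment> \<open>Taking \<open>c\<close> for both remaining arguments shows that multiplication
    by \<open>c\<close> is annihilated by \<open>t (2t - 1) (t - 1)\<close>.\<close>
  then show ?thesis
    using linearized_jordan_identity[of x c c]
    by (simp add: cc commute[of x c] commute[of "c \<odot> x" c])
qed

text \<open>The multiplication by \<open>c\<close> has spectrum in \<open>{0, 1/2, 1}\<close>, and
  \<open>t = t\<^sup>2 + 4 (t - t\<^sup>2)\<^sup>2\<close> holds at these three points.\<close>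

lemma inner_idempotent_square:
  assumes "idempotent (\<odot>) c"
  shows "inner c (x \<odot> x) = (norm (c \<odot> x))\<^sup>2 + 4 * (norm (c \<odot> x - c \<odot> (c \<odot> x)))\<^sup>2"
proof -
  note p = peirce_identity[OF assms, THEN arg_cong, where f = "\<lambda>v. inner x v"]
  have 1: "inner c (x \<odot> x) = inner x (c \<odot> x)"
    by (metis inner_jprod_swap inner_commute)
  have 2: "inner (c \<odot> y) z = inner y (c \<odot> z)" for y z
    by (rule inner_assoc)
  show ?thesis
    using p[of x] p[of "c \<odot> x"]
    by (simp add: 1 power2_norm_eq_inner inner_diff_left inner_diff_right inner_add_right
        2 jprod_simps)
qed

lemma inner_idempotent_square_nonneg:
  assumes "idempotent (\<odot>) c"
  shows "0 \<le> inner c (x \<odot> x)"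
  by (simp add: inner_idempotent_square[OF assms])

lemma inner_idempotents_nonneg:
  assumes "idempotent (\<odot>) c" "idempotent (\<odot>) d"
  shows "0 \<le> inner c d"
  using inner_idempotent_square_nonneg[OF assms(1), of d] assms(2) by (simp add: idempotent_def)

text \<open>Since \<open>d = d \<odot> d\<close>, the number \<open>inner c d\<close> is a sum of
  two squares, one of them that of the norm of \<open>c \<odot> d\<close>.\<close>

lemma idempotents_orthogonal_iff:
  assumes c: "idempotent (\<odot>) c" and d: "idempotent (\<odot>) d"
  shows "c \<odot> d = 0 \<longleftrightarrow> inner c d = 0"
proof
  assume "c \<odot> d = 0"
  then show "inner c d = 0" using inner_unit[of c d] by simp
next
  assume "inner c d = 0"
  then have "(norm (c \<odot> d))\<^sup>2 + 4 * (norm (c \<odot> d - c \<odot> (c \<odot> d)))\<^sup>2 = 0"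
    using inner_idempotent_square[OF c, of d] d by (simp add: idempotent_def)
  then have "(norm (c \<odot> d))\<^sup>2 = 0"
    by (smt (verit) zero_le_power2)
  then show "c \<odot> d = 0" by simp
qed

section \<open>Existence of Jordan frames, by refining systems of nonzero idempotents\<close>

definition idempotent_system :: "'a set \<Rightarrow> bool" where
  "idempotent_system F \<longleftrightarrow> finite F \<and> (\<forall>c\<in>F. idempotent (\<odot>) c \<and> c \<noteq> 0) \<and>
     (\<forall>c\<in>F. \<forall>d\<in>F. c \<noteq> d \<longrightarrow> c \<odot> d = 0) \<and> \<Sum>F = e"

lemma idempotent_system_card_le:
  assumes "idempotent_system F"
  shows "card F \<le> DIM('a)"
proof -
  have "pairwise orthogonal F"
    using assms unfolding idempotent_system_def pairwise_def orthogonal_def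
    using idempotents_orthogonal_iff by blast
  moreover have "0 \<notin> F" using assms by (auto simp: idempotent_system_def)
  ultimately have "independent F" by (rule pairwise_orthogonal_independent)
  then show ?thesis by (simp add: independent_bound)
qed

text \<open>The powers of \<open>x\<close> span an associative subalgebra \<open>A\<close>. An
  orthogonal basis of \<open>A\<close> that diagonalises multiplication by \<open>x\<close>
  consists, up to scaling, of mutually orthogonal idempotents.\<close>

lemma idempotent_system_exists: "\<exists>F. idempotent_system F \<and> x \<in> span F"
proof -
  define A where "A = span (range (jpow x))"
  have eA: "e \<in> A" and xA: "x \<in> A"
    using span_base[OF rangeI, of "jpow x" 0] span_base[OF rangeI, of "jpow x" 1]
    by (simp_all add: A_def unit_right)
  \<comment> \<open>Two facts in one span induction: \<open>A\<close> is closed under multiplication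
    by powers, and on \<open>A\<close> multiplication by a power is an iterate of multiplication by
    \<open>x\<close>.\<close>
  have powA: "jpow x k \<odot> v \<in> A \<and> jpow x (Suc k) \<odot> v = x \<odot> (jpow x k \<odot> v)" if "v \<in> A" for k v
    using that unfolding A_def
  proof (induction rule: span_induct)
    case base
    show ?case
      by (auto simp: subspace_def jprod_simps intro: span_add span_scale span_zero)
  next
    case (step v)
    then obtain m where "v = jpow x m" by blast
    then show ?case
      using jpow_add[of x k m] jpow_add[of x "Suc k" m] by (auto intro: span_base)
  qed
  have invA: "x \<odot> v \<in> A" if "v \<in> A" for v
    using powA[OF that, of 1] by (simp add: unit_right)
  have sa: "inner (x \<odot> u) v = inner u (x \<odot> v)" for u v by (rule inner_assoc)
  have sub: "subspace A" unfolding A_def by simp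
  obtain B where B: "finite B" "0 \<notin> B" "B \<subseteq> A" "span B = A" "pairwise orthogonal B"
      "\<forall>v\<in>B. \<exists>\<mu>. x \<odot> v = \<mu> *\<^sub>R v"
    using self_adjoint_eigenbasis[OF linear_jprod sa sub invA] by blast
  have eig: "\<exists>\<mu>. a \<odot> v = \<mu> *\<^sub>R v" if "v \<in> B" "a \<in> A" for a v
    using that(2) unfolding A_def
  proof (induction rule: span_induct)
    case base
    have "r *\<^sub>R a \<odot> v = (r * \<mu>) *\<^sub>R v" if "a \<odot> v = \<mu> *\<^sub>R v" for r a \<mu>
      using that by (simp add: jprod_simps)
    moreover have "(a + b) \<odot> v = (\<mu> + \<nu>) *\<^sub>R v" if "a \<odot> v = \<mu> *\<^sub>R v" "b \<odot> v = \<nu> *\<^sub>R v" for a b \<mu> \<nu>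
      using that by (simp add: jprod_simps scaleR_add_left)
    ultimately show ?case
      unfolding subspace_def by (auto simp: jprod_simps intro: exI[of _ 0])
  next
    case (step a)
    then obtain k where k: "a = jpow x k" by blast
    obtain \<mu> where \<mu>: "x \<odot> v = \<mu> *\<^sub>R v" using B \<open>v \<in> B\<close> by blast
    have "jpow x k \<odot> v = \<mu> ^ k *\<^sub>R v"
    proof (induction k)
      case 0
      then show ?case by (simp add: unit)
    next
      case (Suc k)
      have "jpow x (Suc k) \<odot> v = x \<odot> (jpow x k \<odot> v)" using powA B \<open>v \<in> B\<close> by blast
      with Suc show ?case using \<mu> by (simp add: jprod_simps mult.commute)
    qed
    with k show ?case by blast
  qed
  have "\<exists>\<mu>. \<mu> \<noteq> 0 \<and> v \<odot> v = \<mu> *\<^sub>R v" if "v \<in> B" for v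
  proof -
    obtain \<mu> where \<mu>: "v \<odot> v = \<mu> *\<^sub>R v" using eig[of v v] B(3) \<open>v \<in> B\<close> by blast
    have "v \<noteq> 0" using B that by auto
    then have "v \<odot> v \<noteq> 0" using inner_unit[of v v] by auto
    then show ?thesis using \<mu> by auto
  qed
  then obtain m where m: "\<And>v. v \<in> B \<Longrightarrow> m v \<noteq> 0 \<and> v \<odot> v = m v *\<^sub>R v" by metis
  \<comment> \<open>The product \<open>v \<odot> w\<close> is a multiple of \<open>v\<close> and
    also of \<open>w\<close>, and these are orthogonal.\<close>
  have orth: "v \<odot> w = 0" if "v \<in> B" "w \<in> B" "v \<noteq> w" for v w
  proof -
    obtain \<mu> \<nu> where "w \<odot> v = \<mu> *\<^sub>R v" "v \<odot> w = \<nu> *\<^sub>R w"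
      using eig[of v w] eig[of w v] B(3) \<open>v \<in> B\<close> \<open>w \<in> B\<close> by blast
    then have "inner (v \<odot> w) (v \<odot> w) = \<mu> * \<nu> * inner v w"
      by (metis commute inner_scaleR_left inner_scaleR_right mult.assoc mult.left_commute)
    also have "\<dots> = 0" using B(5) that by (auto simp: pairwise_def orthogonal_def)
    finally show ?thesis by simp
  qed
  define g where "g v = (1 / m v) *\<^sub>R v" for v
  define F where "F = g ` B"
  have gid: "g v \<odot> g v = g v" "g v \<noteq> 0" if "v \<in> B" for v
    using m[OF that] B(2) that by (auto simp: g_def jprod_simps)
  have gorth: "g v \<odot> g w = 0" if "v \<in> B" "w \<in> B" "v \<noteq> w" for v w
    using orth[OF that] by (simp add: g_def jprod_simps)
  have Forth: "c \<odot> d = 0" if "c \<in> F" "d \<in> F" "c \<noteq> d" for c d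
    using that gorth unfolding F_def by auto
  have Fid: "c \<odot> c = c" "c \<noteq> 0" if "c \<in> F" for c
    using that gid unfolding F_def by auto
  have fin: "finite F" using B by (simp add: F_def)
  have "B \<subseteq> span F"
  proof
    fix v assume "v \<in> B"
    then have "v = m v *\<^sub>R g v" using m by (simp add: g_def)
    then show "v \<in> span F" using \<open>v \<in> B\<close> unfolding F_def by (metis image_eqI span_base span_scale)
  qed
  then have AF: "A \<subseteq> span F" using B(4) span_minimal by (metis subspace_span)
  then obtain h where h: "e = (\<Sum>c\<in>F. h c *\<^sub>R c)"
    using eA span_finite[OF fin] by auto
  \<comment> \<open>Multiplying the expansion of \<open>e\<close> by \<open>c\<close> gives
    \<open>c = h c *\<^sub>R c\<close>.\<close>
  have "h c = 1" if "c \<in> F" for c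
  proof -
    have "c = (\<Sum>d\<in>F. h d *\<^sub>R d) \<odot> c" using unit[of c] h by simp
    also have "\<dots> = (\<Sum>d\<in>F. if d = c then h c *\<^sub>R c else 0)"
      unfolding jprod_sum_left using Forth Fid that by (intro sum.cong) (auto simp: jprod_simps)
    also have "\<dots> = h c *\<^sub>R c" using fin that by simp
    finally have "(h c - 1) *\<^sub>R c = 0" by (simp add: algebra_simps)
    then show ?thesis using Fid that by auto
  qed
  then have "\<Sum>F = e" using h by simp
  then have "idempotent_system F"
    unfolding idempotent_system_def idempotent_def using fin Forth Fid by blast
  then show ?thesis using xA AF by blast
qed

lemma idempotent_summands_orthogonal:
  assumes "idempotent (\<odot>) u" "idempotent (\<odot>) v" "idempotent (\<odot>) (u + v)"
  shows "u \<odot> v = 0"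
proof -
  have "u + v + 2 *\<^sub>R (u \<odot> v) = u + v"
    using assms by (simp add: idempotent_def jprod_simps commute[of v u] scaleR_2 add_ac)
  then show ?thesis by simp
qed

text \<open>Replacing \<open>c\<close> by its summands keeps orthogonality: for another member
  \<open>d\<close>, the nonnegative numbers \<open>inner u d\<close> and \<open>inner v d\<close>
  add up to \<open>inner c d = 0\<close>.\<close>

lemma idempotent_system_refine:
  assumes F: "idempotent_system F" and c: "c \<in> F"
    and u: "idempotent (\<odot>) u" "u \<noteq> 0" and v: "idempotent (\<odot>) v" "v \<noteq> 0" and cuv: "c = u + v"
  shows "\<exists>F'. idempotent_system F' \<and> span F \<subseteq> span F' \<and> card F < card F'"
proof -
  let ?G = "F - {c}" and ?F = "insert u (insert v (F - {c}))"
  have fin: "finite F" using F by (simp add: idempotent_system_def)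
  have uv: "u \<odot> v = 0"
    using idempotent_summands_orthogonal u v F c cuv by (auto simp: idempotent_system_def)
  have G: "u \<odot> d = 0 \<and> v \<odot> d = 0" if "d \<in> ?G" for d
  proof -
    have d: "idempotent (\<odot>) d" and ci: "idempotent (\<odot>) c" and cd: "c \<odot> d = 0"
      using F that c by (auto simp: idempotent_system_def)
    then have "inner u d + inner v d = 0"
      using idempotents_orthogonal_iff[OF ci d] by (simp add: cuv inner_add_left)
    moreover have "0 \<le> inner u d" "0 \<le> inner v d" using inner_idempotents_nonneg u v d by auto
    ultimately show ?thesis
      using idempotents_orthogonal_iff u v d by (metis add_nonneg_eq_0_iff)
  qed
  have new: "u \<noteq> v" "u \<notin> ?G" "v \<notin> ?G"
    using uv G u v unfolding idempotent_def by metis+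
  have "\<Sum>?F = u + (v + \<Sum>?G)" using new fin by simp
  also have "\<dots> = \<Sum>F" using fin c cuv by (simp add: sum.remove add.assoc)
  finally have "\<Sum>?F = e" using F by (simp add: idempotent_system_def)
  then have "idempotent_system ?F"
    using F u v uv G commute unfolding idempotent_system_def by (auto simp: commute[of v u])
  moreover have "F \<subseteq> span ?F"
  proof
    fix d assume "d \<in> F"
    show "d \<in> span ?F"
    proof (cases "d = c")
      case True
      then show ?thesis using cuv by (auto intro: span_add span_base)
    qed (use \<open>d \<in> F\<close> in \<open>auto intro: span_base\<close>)
  qed
  then have "span F \<subseteq> span ?F" by (simp add: span_minimal)
  moreover have "card ?F = Suc (card F)"
    using new fin card_Suc_Diff1[OF fin c] by simp
  ultimately show ?thesis by (intro exI[of _ ?F]) simp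
qed

text \<open>Cardinalities are bounded by the dimension, so a largest system with \<open>x\<close> in
  its span exists; a non-primitive member could be split further.\<close>

lemma jordan_frame_exists: "\<exists>F. jordan_frame (\<odot>) e F \<and> x \<in> span F"
proof -
  define P where "P F \<longleftrightarrow> idempotent_system F \<and> x \<in> span F" for F
  obtain F0 where "P F0" using idempotent_system_exists P_def by blast
  have "card F < Suc DIM('a)" if "P F" for F
    using that idempotent_system_card_le[of F] by (simp add: P_def)
  with \<open>P F0\<close> obtain F where F: "P F" and mx: "\<And>G. P G \<Longrightarrow> card G \<le> card F"
    using ex_has_greatest_nat[of P F0 card "Suc DIM('a)"] by blast
  have "primitive_idempotent (\<odot>) c" if "c \<in> F" for c
  proof -
    have False if uv: "idempotent (\<odot>) u" "u \<noteq> 0" "idempotent (\<odot>) v" "v \<noteq> 0" "c = u + v" for u v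
    proof -
      have "idempotent_system F" "x \<in> span F" using F by (simp_all add: P_def)
      then obtain G where "P G" "card F < card G"
        using idempotent_system_refine[OF _ \<open>c \<in> F\<close> uv] unfolding P_def by blast
      then show False using mx by fastforce
    qed
    moreover have "idempotent (\<odot>) c" "c \<noteq> 0"
      using F that by (simp_all add: P_def idempotent_system_def)
    ultimately show ?thesis unfolding primitive_idempotent_def by blast
  qed
  then have "jordan_frame (\<odot>) e F \<and> x \<in> span F"
    using F by (simp add: P_def jordan_frame_def idempotent_system_def)
  then show ?thesis by blast
qed

text \<open>The key \<open>g\<close> fixes the order of the frame: the identity sorts by eigenvalue,
  \<open>abs\<close> by absolute eigenvalue.\<close>

lemma spectral_decomposition_exists:
  fixes g :: "real \<Rightarrow> real"
  shows "\<exists>es xs. spectral_decomposition (\<odot>) e x es xs \<and> sorted_wrt (\<ge>) (map g xs)"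
proof -
  obtain F where F: "jordan_frame (\<odot>) e F" "x \<in> span F" using jordan_frame_exists by blast
  then have fin: "finite F" by (simp add: jordan_frame_def)
  obtain h where h: "x = (\<Sum>c\<in>F. h c *\<^sub>R c)" using F span_finite[OF fin] by auto
  obtain l where l: "set l = F" "distinct l" using finite_distinct_list[OF fin] by blast
  define es where "es = rev (sort_key (\<lambda>c. g (h c)) l)"
  have es: "set es = F" "distinct es" using l by (simp_all add: es_def)
  have "(\<Sum>i<length es. map h es ! i *\<^sub>R es ! i) = (\<Sum>i<length es. (\<lambda>c. h c *\<^sub>R c) (es ! i))"
    by (intro sum.cong) auto
  also have "\<dots> = (\<Sum>c\<in>F. h c *\<^sub>R c)"
    using sum.reindex_bij_betw[OF bij_betw_nth[OF es(2) refl es(1)[symmetric]], of "\<lambda>c. h c *\<^sub>R c"] by simp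
  finally have "spectral_decomposition (\<odot>) e x es (map h es)"
    using es F h by (simp add: spectral_decomposition_def)
  moreover have "sorted_wrt (\<ge>) (map g (map h es))"
    using sorted_sort_key[of "\<lambda>c. g (h c)" l]
    by (simp add: es_def sorted_wrt_rev rev_map[symmetric] comp_def)
  ultimately show ?thesis by blast
qed


section \<open>Comparing two spectral decompositions of one element\<close>

lemma spectral_decomposition_frame:
  assumes "spectral_decomposition (\<odot>) e x es xs"
  shows "length xs = length es" "x = (\<Sum>i<length es. xs ! i *\<^sub>R es ! i)"
    "(\<Sum>i<length es. es ! i) = e"
    "\<And>i. i < length es \<Longrightarrow> primitive_idempotent (\<odot>) (es ! i)"
    "\<And>i. i < length es \<Longrightarrow> idempotent (\<odot>) (es ! i)"
    "\<And>i. i < length es \<Longrightarrow> es ! i \<noteq> 0"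
    "\<And>i j. i < length es \<Longrightarrow> j < length es \<Longrightarrow> i \<noteq> j \<Longrightarrow> es ! i \<odot> es ! j = 0"
proof -
  have d: "distinct es" and F: "jordan_frame (\<odot>) e (set es)"
    using assms by (simp_all add: spectral_decomposition_def)
  show "length xs = length es" "x = (\<Sum>i<length es. xs ! i *\<^sub>R es ! i)"
    using assms by (simp_all add: spectral_decomposition_def)
  show "(\<Sum>i<length es. es ! i) = e"
    using F sum.reindex_bij_betw[OF bij_betw_nth[OF d refl refl], of "\<lambda>c. c"]
    by (simp add: jordan_frame_def)
  show p: "primitive_idempotent (\<odot>) (es ! i)" if "i < length es" for i
    using F that by (simp add: jordan_frame_def)
  show "idempotent (\<odot>) (es ! i)" "es ! i \<noteq> 0" if "i < length es" for i
    using p[OF that] by (simp_all add: primitive_idempotent_def)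
  show "es ! i \<odot> es ! j = 0" if "i < length es" "j < length es" "i \<noteq> j" for i j
    using F d that by (simp add: jordan_frame_def nth_eq_iff_index_eq)
qed

lemma spectral_decomposition_change:
  assumes "spectral_decomposition (\<odot>) e x es xs" "length ys = length es"
  shows "spectral_decomposition (\<odot>) e (\<Sum>i<length es. ys ! i *\<^sub>R es ! i) es ys"
  using assms by (simp add: spectral_decomposition_def)

lemma frame_combination_jprod:
  assumes "spectral_decomposition (\<odot>) e x es xs" "I \<subseteq> {..<length es}" "i < length es"
  shows "(\<Sum>j\<in>I. h j *\<^sub>R es ! j) \<odot> es ! i = (if i \<in> I then h i *\<^sub>R es ! i else 0)"
proof -
  note f = spectral_decomposition_frame[OF assms(1)]
  have fin: "finite I" using assms(2) finite_subset by blast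
  have "(\<Sum>j\<in>I. h j *\<^sub>R es ! j) \<odot> es ! i = (\<Sum>j\<in>I. if j = i then h i *\<^sub>R es ! i else 0)"
    unfolding jprod_sum_left using f(5,7) assms(2,3)
    by (intro sum.cong) (auto simp: jprod_simps idempotent_def)
  then show ?thesis using fin by simp
qed

lemma spectral_decomposition_eigen:
  assumes "spectral_decomposition (\<odot>) e x es xs" "i < length es"
  shows "x \<odot> es ! i = xs ! i *\<^sub>R es ! i"
  using frame_combination_jprod[OF assms(1) order_refl assms(2), of "\<lambda>i. xs ! i"]
    spectral_decomposition_frame(2)[OF assms(1)] assms(2) by simp

text \<open>Multiplication by \<open>x\<close> is self-adjoint, so eigenvectors for different
  eigenvalues have inner product zero; for idempotents this forces a zero product.\<close>

lemma eigenidempotents_orthogonal: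
  assumes x: "spectral_decomposition (\<odot>) e x es xs" and y: "spectral_decomposition (\<odot>) e x fs ys"
    and i: "i < length es" and j: "j < length fs" and ne: "xs ! i \<noteq> ys ! j"
  shows "es ! i \<odot> fs ! j = 0"
proof -
  have "xs ! i * inner (es ! i) (fs ! j) = inner (x \<odot> es ! i) (fs ! j)"
    using spectral_decomposition_eigen[OF x i] by simp
  also have "\<dots> = inner (es ! i) (x \<odot> fs ! j)" by (rule inner_assoc)
  also have "\<dots> = ys ! j * inner (es ! i) (fs ! j)"
    using spectral_decomposition_eigen[OF y j] by simp
  finally have "inner (es ! i) (fs ! j) = 0" using ne by simp
  then show ?thesis
    using idempotents_orthogonal_iff spectral_decomposition_frame(5) x y i j by blast
qed

lemma frame_expand:
  assumes "spectral_decomposition (\<odot>) e y fs ys"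
  shows "z = (\<Sum>j<length fs. z \<odot> fs ! j)"
  using spectral_decomposition_frame(3)[OF assms] unit_right[of z]
  by (simp add: jprod_sum_right[symmetric])

text \<open>Both sides equal the double sum of \<open>g (xs ! i)\<close> times \<open>es ! i \<odot> fs ! j\<close>, since the
  product vanishes unless \<open>xs ! i = ys ! j\<close>.\<close>

lemma functional_calculus_unique:
  assumes x: "spectral_decomposition (\<odot>) e x es xs" and y: "spectral_decomposition (\<odot>) e x fs ys"
  shows "(\<Sum>i<length es. g (xs ! i) *\<^sub>R es ! i) = (\<Sum>j<length fs. g (ys ! j) *\<^sub>R fs ! j)"
proof -
  have "(\<Sum>i<length es. g (xs ! i) *\<^sub>R es ! i)
      = (\<Sum>i<length es. \<Sum>j<length fs. g (xs ! i) *\<^sub>R (es ! i \<odot> fs ! j))"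
    unfolding scaleR_sum_right[symmetric] using frame_expand[OF y] by simp
  also have "\<dots> = (\<Sum>i<length es. \<Sum>j<length fs. g (ys ! j) *\<^sub>R (es ! i \<odot> fs ! j))"
    using eigenidempotents_orthogonal[OF x y] by (intro sum.cong refl) (metis lessThan_iff scaleR_zero_right)
  also have "\<dots> = (\<Sum>j<length fs. \<Sum>i<length es. g (ys ! j) *\<^sub>R (fs ! j \<odot> es ! i))"
    by (subst sum.swap) (simp add: commute)
  also have "\<dots> = (\<Sum>j<length fs. g (ys ! j) *\<^sub>R fs ! j)"
    unfolding scaleR_sum_right[symmetric] using frame_expand[OF x] by simp
  finally show ?thesis .
qed

text \<open>Expanding the nonzero \<open>es ! i\<close> in the second frame leaves some nonzero
  \<open>es ! i \<odot> fs ! j\<close>, which forces equal eigenvalues.\<close>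

lemma spectrum_subset:
  assumes x: "spectral_decomposition (\<odot>) e x es xs" and y: "spectral_decomposition (\<odot>) e x fs ys"
  shows "set xs \<subseteq> set ys"
proof
  fix r assume "r \<in> set xs"
  then obtain i where i: "i < length es" "r = xs ! i"
    using spectral_decomposition_frame(1)[OF x] by (auto simp: in_set_conv_nth)
  have "(\<Sum>j<length fs. es ! i \<odot> fs ! j) \<noteq> 0"
    using frame_expand[OF y, of "es ! i"] spectral_decomposition_frame(6)[OF x i(1)] by simp
  then obtain j where j: "j < length fs" "es ! i \<odot> fs ! j \<noteq> 0"
    by (meson lessThan_iff sum.neutral)
  then have "xs ! i = ys ! j" using eigenidempotents_orthogonal[OF x y i(1)] by blast
  then show "r \<in> set ys"
    using i j spectral_decomposition_frame(1)[OF y] by simp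
qed

text \<open>A repeated value in \<open>ys\<close> would split the corresponding
  \<open>es ! i\<close> into two nonzero idempotents, contradicting primitivity.\<close>

lemma distinct_spectrum_transfer:
  assumes x: "spectral_decomposition (\<odot>) e x es xs" and y: "spectral_decomposition (\<odot>) e x fs ys"
    and dist: "distinct xs"
  shows "distinct ys"
proof (rule ccontr)
  note fx = spectral_decomposition_frame[OF x] and fy = spectral_decomposition_frame[OF y]
  assume "\<not> distinct ys"
  then obtain j k where jk: "j < length fs" "k < length fs" "j \<noteq> k" "ys ! j = ys ! k"
    using fy(1) by (auto simp: distinct_conv_nth)
  have "ys ! j \<in> set xs" using spectrum_subset[OF y x] jk fy(1) by auto
  then obtain i where i: "i < length es" "xs ! i = ys ! j"
    using fx(1) by (auto simp: in_set_conv_nth)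
  define J where "J = {m \<in> {..<length fs}. ys ! m = ys ! j}"
  \<comment> \<open>Functional calculus is applied to the indicator of the repeated value, which
    occurs only once in \<open>xs\<close>.\<close>
  have "es ! i = (\<Sum>m<length es. (if xs ! m = ys ! j then 1 else 0) *\<^sub>R es ! m)"
  proof -
    have "(\<Sum>m<length es. (if xs ! m = ys ! j then 1 else 0) *\<^sub>R es ! m)
        = (\<Sum>m<length es. if m = i then es ! i else 0)"
      unfolding i(2)[symmetric] using i(1) dist fx(1)
      by (intro sum.cong) (auto simp: nth_eq_iff_index_eq)
    then show ?thesis using i(1) by simp
  qed
  also have "\<dots> = (\<Sum>m<length fs. (if ys ! m = ys ! j then 1 else 0) *\<^sub>R fs ! m)"
    by (rule functional_calculus_unique[OF x y])
  also have "\<dots> = (\<Sum>m\<in>J. fs ! m)"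
    by (auto simp: J_def sum.If_cases if_distrib[of "\<lambda>r. r *\<^sub>R _"] intro!: sum.mono_neutral_cong_right)
  also have "\<dots> = fs ! j + (\<Sum>m\<in>J - {j}. fs ! m)"
    using jk by (intro sum.remove) (auto simp: J_def)
  finally have split: "es ! i = fs ! j + (\<Sum>m\<in>J - {j}. fs ! m)" .
  let ?s = "\<Sum>m\<in>J - {j}. fs ! m"
  have sm: "?s \<odot> fs ! m = (if m \<in> J - {j} then fs ! m else 0)" if "m < length fs" for m
  proof -
    have "J - {j} \<subseteq> {..<length fs}" by (auto simp: J_def)
    from frame_combination_jprod[OF y this that, of "\<lambda>_. 1"] show ?thesis by simp
  qed
  have "?s \<odot> ?s = (\<Sum>m\<in>J - {j}. ?s \<odot> fs ! m)" by (rule jprod_sum_right)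
  also have "\<dots> = ?s" using sm by (intro sum.cong) (auto simp: J_def)
  finally have "idempotent (\<odot>) ?s" by (simp add: idempotent_def)
  \<comment> \<open>Multiplication by \<open>fs ! k\<close> detects the second occurrence
    \<open>k\<close>, which lies in \<open>J - {j}\<close>.\<close>
  moreover have "?s \<noteq> 0"
    using sm[of k] jk fy(6)[of k] by (auto simp: J_def jprod_simps)
  ultimately have "\<not> primitive_idempotent (\<odot>) (es ! i)"
    using split fy(5,6)[OF jk(1)] unfolding primitive_idempotent_def by metis
  then show False using fx(4)[OF i(1)] by blast
qed

text \<open>Uniqueness is a hypothesis because it is first available only for distinct coefficients;
  the general case comes later, through the trace.\<close>

lemma eigenvalues_eqI:
  assumes "\<And>fs ys. spectral_decomposition (\<odot>) e x fs ys \<Longrightarrow> mset ys = mset xs"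
  shows "eigenvalues (\<odot>) e x = rev (sort xs)"
proof -
  have *: "ys = rev (sort xs)"
    if "sorted_wrt (\<ge>) ys" "spectral_decomposition (\<odot>) e x fs ys" for fs ys
  proof -
    have "sort xs = rev ys"
      using assms[OF that(2)] that(1) by (intro properties_for_sort) (simp_all add: sorted_wrt_rev)
    then show ?thesis by simp
  qed
  obtain es zs where "spectral_decomposition (\<odot>) e x es zs" "sorted_wrt (\<ge>) zs"
    using spectral_decomposition_exists[of x "\<lambda>r. r"] by auto
  then show ?thesis
    unfolding eigenvalues_def using * by (intro the_equality) blast+
qed

text \<open>Without repetitions, equal sets of eigenvalues already give equal multisets, so the
  trace is computed before multiplicities are understood.\<close>

lemma jordan_trace_distinct:
  assumes x: "spectral_decomposition (\<odot>) e x es xs" and dist: "distinct xs"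
  shows "jordan_trace (\<odot>) e x = sum_list xs"
proof -
  have "mset ys = mset xs" if y: "spectral_decomposition (\<odot>) e x fs ys" for fs ys
    using spectrum_subset[OF x y] spectrum_subset[OF y x] distinct_spectrum_transfer[OF x y dist] dist
    by (metis set_eq_iff_mset_eq_distinct subset_antisym)
  from eigenvalues_eqI[OF this] have "mset (eigenvalues (\<odot>) e x) = mset xs" by simp
  then show ?thesis unfolding jordan_trace_def by (metis sum_mset_sum_list)
qed

lemma jordan_abs_eq:
  assumes "spectral_decomposition (\<odot>) e x es xs"
  shows "jordan_abs (\<odot>) e x = (\<Sum>i<length es. \<bar>xs ! i\<bar> *\<^sub>R es ! i)"
  unfolding jordan_abs_def
proof (rule the_equality)
  show "\<exists>fs ys. spectral_decomposition (\<odot>) e x fs ys \<and>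
      (\<Sum>i<length es. \<bar>xs ! i\<bar> *\<^sub>R es ! i) = (\<Sum>i<length fs. \<bar>ys ! i\<bar> *\<^sub>R fs ! i)"
    by (rule exI[of _ es], rule exI[of _ xs]) (use assms in simp)
next
  fix y
  assume "\<exists>fs ys. spectral_decomposition (\<odot>) e x fs ys \<and> y = (\<Sum>i<length fs. \<bar>ys ! i\<bar> *\<^sub>R fs ! i)"
  then obtain fs ys where y: "spectral_decomposition (\<odot>) e x fs ys"
      "y = (\<Sum>i<length fs. \<bar>ys ! i\<bar> *\<^sub>R fs ! i)" by blast
  then show "y = (\<Sum>i<length es. \<bar>xs ! i\<bar> *\<^sub>R es ! i)"
    using functional_calculus_unique[OF y(1) assms, of abs] by simp
qed

section \<open>Elements of spectral norm at most one, tested against idempotents\<close>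

definition dominated_square :: "'a \<Rightarrow> bool" where
  "dominated_square t \<longleftrightarrow> (\<forall>c. idempotent (\<odot>) c \<longrightarrow> inner c (t \<odot> t) \<le> inner c e)"

text \<open>Squaring the sum squares its coefficients, which stay at most 1; the terms
  \<open>inner c (es ! i)\<close> are nonnegative and over the whole frame add up to
  \<open>inner c e\<close>.\<close>

lemma dominated_square_partial_frame:
  assumes x: "spectral_decomposition (\<odot>) e x es xs" and l: "l \<le> length es"
    and h: "\<And>i. \<bar>h i\<bar> \<le> 1"
  shows "dominated_square (\<Sum>i<l. h i *\<^sub>R es ! i)"
  unfolding dominated_square_def
proof (intro allI impI)
  fix c assume c: "idempotent (\<odot>) c"
  let ?t = "\<Sum>i<l. h i *\<^sub>R es ! i"
  note f = spectral_decomposition_frame[OF x]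
  have "?t \<odot> ?t = (\<Sum>i<l. h i *\<^sub>R (?t \<odot> es ! i))"
    by (simp add: jprod_sum_right jprod_simps)
  also have "\<dots> = (\<Sum>i<l. (h i)\<^sup>2 *\<^sub>R es ! i)"
    using frame_combination_jprod[OF x, of "{..<l}"] l
    by (intro sum.cong) (auto simp: power2_eq_square)
  finally have "inner c (?t \<odot> ?t) = (\<Sum>i<l. (h i)\<^sup>2 * inner c (es ! i))"
    by (simp add: inner_sum_right)
  also have "\<dots> \<le> (\<Sum>i<l. inner c (es ! i))"
  proof (rule sum_mono)
    fix i assume "i \<in> {..<l}"
    then have "0 \<le> inner c (es ! i)" using inner_idempotents_nonneg[OF c] f(5) l by auto
    moreover have "(h i)\<^sup>2 \<le> 1" using h[of i] by (simp add: abs_square_le_1)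
    ultimately show "(h i)\<^sup>2 * inner c (es ! i) \<le> inner c (es ! i)"
      by (simp add: mult_left_le_one_le)
  qed
  also have "\<dots> \<le> (\<Sum>i<length es. inner c (es ! i))"
    using inner_idempotents_nonneg[OF c] f(5) l by (intro sum_mono2) auto
  also have "\<dots> = inner c e" using f(3) by (simp add: inner_sum_right[symmetric])
  finally show "inner c (?t \<odot> ?t) \<le> inner c e" .
qed

text \<open>A Cauchy-Schwarz argument: pair \<open>c\<close> with the squares of
  \<open>t - u\<close> and \<open>t + u\<close>.\<close>

lemma dominated_square_product:
  assumes t: "dominated_square t" and u: "dominated_square u" and c: "idempotent (\<odot>) c"
  shows "\<bar>inner c (t \<odot> u)\<bar> \<le> inner c e"
proof -
  have "inner c (t \<odot> t) \<le> inner c e" "inner c (u \<odot> u) \<le> inner c e"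
    using t u c by (simp_all add: dominated_square_def)
  moreover have "0 \<le> inner c ((t - u) \<odot> (t - u))" "0 \<le> inner c ((t + u) \<odot> (t + u))"
    by (rule inner_idempotent_square_nonneg[OF c])+
  then have "2 * inner c (t \<odot> u) \<le> inner c (t \<odot> t) + inner c (u \<odot> u)"
    "- 2 * inner c (t \<odot> u) \<le> inner c (t \<odot> t) + inner c (u \<odot> u)"
    by (simp_all add: jprod_simps inner_add_right inner_diff_right commute[of u t])
  ultimately show ?thesis by linarith
qed

end

section \<open>Consequences of the trace form: rank and multiplicities\<close>

locale trace_jordan_algebra = euclidean_jordan_algebra +
  assumes inner_trace: "inner x y = jordan_trace (\<odot>) e (x \<odot> y)"
begin

lemma frame_inner_unit:
  assumes x: "spectral_decomposition (\<odot>) e x es xs" and i: "i < length es"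
  shows "inner (es ! i) e = 1"
proof -
  let ?n = "length es"
  have *: "(\<Sum>j<?n. h j * inner (es ! j) e) = (\<Sum>j<?n. h j)"
    if "inj_on h {..<?n}" for h :: "nat \<Rightarrow> real"
  proof -
    let ?ys = "map h [0..<?n]"
    let ?y = "\<Sum>j<?n. ?ys ! j *\<^sub>R es ! j"
    have "spectral_decomposition (\<odot>) e ?y es ?ys"
      by (rule spectral_decomposition_change[OF x]) simp
    moreover have "distinct ?ys" using that by (simp add: distinct_map atLeast0LessThan)
    ultimately have "jordan_trace (\<odot>) e ?y = sum_list ?ys" by (rule jordan_trace_distinct)
    then have "inner ?y e = sum_list ?ys" by (simp add: inner_trace unit_right)
    then show ?thesis
      by (simp add: inner_sum_left interv_sum_list_conv_sum_set_nat atLeast0LessThan)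
  qed
  \<comment> \<open>Two injective coefficient choices that differ only at \<open>i\<close>: the
    value \<open>?n\<close> is fresh among the indices. Subtracting their trace formulas isolates
    \<open>inner (es ! i) e\<close>.\<close>
  let ?R = "{..<?n} - {i}" and ?h = "real(i := real ?n)"
  have "inj_on ?h {..<?n}" by (auto simp: inj_on_def)
  from *[OF this] have "real ?n * inner (es ! i) e + (\<Sum>j\<in>?R. real j * inner (es ! j) e)
      = real ?n + (\<Sum>j\<in>?R. real j)"
    using i by (simp add: sum.remove[of "{..<?n}" i])
  moreover from *[of real] have "real i * inner (es ! i) e + (\<Sum>j\<in>?R. real j * inner (es ! j) e)
      = real i + (\<Sum>j\<in>?R. real j)"
    using i by (simp add: sum.remove[of "{..<?n}" i])
  ultimately have "(real ?n - real i) * inner (es ! i) e = (real ?n - real i) * 1"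
    by (simp add: algebra_simps)
  then show ?thesis using i by simp
qed

lemma jordan_frame_card:
  assumes "jordan_frame (\<odot>) e F"
  shows "real (card F) = inner e e"
proof -
  have "finite F" using assms by (simp add: jordan_frame_def)
  then obtain es where es: "set es = F" "distinct es"
    using finite_distinct_list by blast
  \<comment> \<open>Zero coefficients merely present the frame as a spectral decomposition, the form
    in which frame lemmas are stated.\<close>
  have x: "spectral_decomposition (\<odot>) e (\<Sum>i<length es. replicate (length es) 0 ! i *\<^sub>R es ! i)
      es (replicate (length es) 0)"
    using es assms by (simp add: spectral_decomposition_def)
  have "inner e e = (\<Sum>i<length es. inner (es ! i) e)"
    using spectral_decomposition_frame(3)[OF x] by (simp add: inner_sum_left[symmetric])
  also have "\<dots> = length es" using frame_inner_unit[OF x] by simp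
  finally show ?thesis using es distinct_card by metis
qed

lemma length_eq_jordan_rank:
  assumes "spectral_decomposition (\<odot>) e x es xs"
  shows "length es = jordan_rank (\<odot>) e"
proof -
  have F: "jordan_frame (\<odot>) e (set es)" "card (set es) = length es"
    using assms by (simp_all add: spectral_decomposition_def distinct_card)
  show ?thesis
    unfolding jordan_rank_def
  proof (rule the_equality[symmetric])
    show "\<exists>F. jordan_frame (\<odot>) e F \<and> card F = length es" using F by blast
    show "n = length es" if "\<exists>F. jordan_frame (\<odot>) e F \<and> card F = n" for n
      using that jordan_frame_card F by (metis of_nat_eq_iff)
  qed
qed

text \<open>The multiplicity of \<open>r\<close> is read off from its eigenidempotent, the
  functional calculus of an indicator, which is the same for both decompositions.\<close>

lemma spectral_decomposition_mset_unique:
  assumes x: "spectral_decomposition (\<odot>) e x es xs" and y: "spectral_decomposition (\<odot>) e x fs ys"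
  shows "mset xs = mset ys"
proof (rule multiset_eqI)
  fix r
  have *: "real (count (mset zs) r) = inner (\<Sum>i<length gs. of_bool (zs ! i = r) *\<^sub>R gs ! i) e"
    if z: "spectral_decomposition (\<odot>) e x gs zs" for gs zs
  proof -
    have "inner (\<Sum>i<length gs. of_bool (zs ! i = r) *\<^sub>R gs ! i) e = (\<Sum>i<length gs. of_bool (zs ! i = r))"
      unfolding inner_sum_left using frame_inner_unit[OF z] by (intro sum.cong) auto
    also have "\<dots> = card {i. i < length zs \<and> zs ! i = r}"
      using spectral_decomposition_frame(1)[OF z] by (simp add: of_bool_def sum.If_cases Int_def)
    also have "\<dots> = count (mset zs) r"
      by (simp add: count_mset count_list_eq_length_filter length_filter_conv_card eq_commute)
    finally show ?thesis by simp
  qed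
  show "count (mset xs) r = count (mset ys) r"
    using *[OF x] *[OF y] functional_calculus_unique[OF x y, of "\<lambda>s. of_bool (s = r)"] by simp
qed

lemma eigenvalues_abs:
  assumes x: "spectral_decomposition (\<odot>) e x es xs" and s: "sorted_wrt (\<ge>) (map abs xs)"
  shows "eigenvalues (\<odot>) e (jordan_abs (\<odot>) e x) = map abs xs"
proof -
  have "jordan_abs (\<odot>) e x = (\<Sum>i<length es. map abs xs ! i *\<^sub>R es ! i)"
    using jordan_abs_eq[OF x] spectral_decomposition_frame(1)[OF x] by simp
  then have "spectral_decomposition (\<odot>) e (jordan_abs (\<odot>) e x) es (map abs xs)"
    using spectral_decomposition_change[OF x, of "map abs xs"] spectral_decomposition_frame(1)[OF x]
    by simp
  then have "eigenvalues (\<odot>) e (jordan_abs (\<odot>) e x) = rev (sort (map abs xs))"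
    using spectral_decomposition_mset_unique by (intro eigenvalues_eqI) blast
  moreover have "sort (map abs xs) = rev (map abs xs)"
    using s by (intro properties_for_sort) (simp_all add: sorted_wrt_rev)
  ultimately show ?thesis by simp
qed

text \<open>Each of the \<open>l\<close> frame members contributes at most
  \<open>inner (es ! i) e = 1\<close>.\<close>

lemma partial_frame_trilinear_le:
  assumes x: "spectral_decomposition (\<odot>) e x es xs" and l: "l \<le> length es"
    and h: "\<And>i. \<bar>h i\<bar> \<le> 1" and t: "dominated_square t" and u: "dominated_square u"
  shows "inner (\<Sum>i<l. h i *\<^sub>R es ! i) (t \<odot> u) \<le> real l"
proof -
  have "h i * inner (es ! i) (t \<odot> u) \<le> 1" if "i < l" for i
  proof -
    have "\<bar>inner (es ! i) (t \<odot> u)\<bar> \<le> 1"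
      using dominated_square_product[OF t u] spectral_decomposition_frame(5)[OF x]
        frame_inner_unit[OF x] that l by (metis order_less_le_trans)
    then have "\<bar>h i\<bar> * \<bar>inner (es ! i) (t \<odot> u)\<bar> \<le> 1"
      using h[of i] by (simp add: mult_le_one)
    then show ?thesis by (simp add: abs_mult[symmetric])
  qed
  then have "(\<Sum>i<l. h i * inner (es ! i) (t \<odot> u)) \<le> (\<Sum>i<l. 1)"
    by (intro sum_mono) simp
  then show ?thesis by (simp add: inner_sum_left)
qed

end

section \<open>Summation by parts and the eigenvalue inequality\<close>

lemma weighted_sum_mono:
  fixes \<alpha> c d :: "nat \<Rightarrow> real"
  assumes nonneg: "\<And>i. i < n \<Longrightarrow> 0 \<le> \<alpha> i" and decr: "\<And>i. Suc i < n \<Longrightarrow> \<alpha> (Suc i) \<le> \<alpha> i"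
    and le: "\<And>j. j \<le> n \<Longrightarrow> sum c {..<j} \<le> sum d {..<j}"
  shows "(\<Sum>i<n. \<alpha> i * c i) \<le> (\<Sum>i<n. \<alpha> i * d i)"
proof (cases n)
  case (Suc m)
  define f where "f i = d i - c i" for i
  have pos: "0 \<le> sum f {..<j}" if "j \<le> n" for j
    using le[OF that] by (simp add: f_def sum_subtractf)
  \<comment> \<open>Abel summation as an induction: lowering the weight from
    \<open>\<alpha> m\<close> to \<open>\<alpha> (Suc m)\<close> on a nonnegative partial sum only
    loses.\<close>
  have "\<alpha> m * sum f {..<Suc m} \<le> (\<Sum>i<Suc m. \<alpha> i * f i)" if "Suc m \<le> n" for m
    using that
  proof (induction m)
    case (Suc m)
    have "\<alpha> (Suc m) * sum f {..<Suc m} \<le> \<alpha> m * sum f {..<Suc m}"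
      using Suc.prems by (intro mult_right_mono decr pos) auto
    also have "\<dots> \<le> (\<Sum>i<Suc m. \<alpha> i * f i)" using Suc by simp
    finally show ?case
      unfolding sum.lessThan_Suc[of _ "Suc m"] by (simp add: distrib_left)
  qed simp
  from this[of m] have "0 \<le> (\<Sum>i<n. \<alpha> i * f i)"
    using mult_nonneg_nonneg[OF nonneg pos, of m n] Suc by simp
  then show ?thesis by (simp add: f_def right_diff_distrib sum_subtractf)
qed simp

context trace_jordan_algebra
begin

lemma sum_abs_eigenvalues_jprod_le:
  assumes a: "spectral_decomposition (\<odot>) e a es xs" and sa: "sorted_wrt (\<ge>) (map abs xs)"
    and b: "spectral_decomposition (\<odot>) e b fs ys" and sb: "sorted_wrt (\<ge>) (map abs ys)"
    and z: "spectral_decomposition (\<odot>) e (a \<odot> b) gs zs"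
    and len: "length es = n" "length fs = n" "length gs = n" and k: "k \<le> n"
  shows "(\<Sum>i<k. \<bar>zs ! i\<bar>) \<le> (\<Sum>i<k. \<bar>xs ! i\<bar> * \<bar>ys ! i\<bar>)"
proof -
  note fa = spectral_decomposition_frame[OF a] and fb = spectral_decomposition_frame[OF b]
    and fz = spectral_decomposition_frame[OF z]
  have sgn1: "\<bar>sgn r\<bar> \<le> 1" for r :: real by (simp add: sgn_if)
  define s where "s j = (\<Sum>i<j. sgn (xs ! i) *\<^sub>R es ! i)" for j
  define t where "t j = (\<Sum>i<j. sgn (ys ! i) *\<^sub>R fs ! i)" for j
  \<comment> \<open>The signs make \<open>inner (a \<odot> b) u\<close> the sum of the first
    \<open>k\<close> absolute eigenvalues.\<close>
  define u where "u = (\<Sum>i<k. sgn (zs ! i) *\<^sub>R gs ! i)"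
  have ds: "dominated_square (s j)" if "j \<le> n" for j
    unfolding s_def using that len sgn1 by (intro dominated_square_partial_frame[OF a]) auto
  have dt: "dominated_square (t j)" if "j \<le> n" for j
    unfolding t_def using that len sgn1 by (intro dominated_square_partial_frame[OF b]) auto
  have du: "dominated_square u"
    unfolding u_def using k len sgn1 by (intro dominated_square_partial_frame[OF z]) auto
  \<comment> \<open>The trilinear form is symmetric, so each of its three arguments can be the one
    that is expanded, yielding three bounds on one number.\<close>
  have stu: "inner (s j) (t l \<odot> u) \<le> real (min j (min l k))" if "j \<le> n" "l \<le> n" for j l
  proof -
    have "inner (s j) (t l \<odot> u) \<le> j"
      unfolding s_def using that len sgn1 by (intro partial_frame_trilinear_le[OF a _ _ dt du]) auto
    moreover have "inner (t l) (s j \<odot> u) \<le> l"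
      unfolding t_def using that len sgn1 by (intro partial_frame_trilinear_le[OF b _ _ ds du]) auto
    moreover have "inner u (s j \<odot> t l) \<le> k"
      unfolding u_def using that len sgn1 k by (intro partial_frame_trilinear_le[OF z _ _ ds dt]) auto
    moreover have "inner (t l) (s j \<odot> u) = inner (s j) (t l \<odot> u)"
      "inner u (s j \<odot> t l) = inner (s j) (t l \<odot> u)"
      by (metis commute inner_commute inner_jprod_swap)+
    ultimately show ?thesis by simp
  qed
  have decr: "\<bar>xs ! Suc i\<bar> \<le> \<bar>xs ! i\<bar>" "\<bar>ys ! Suc i\<bar> \<le> \<bar>ys ! i\<bar>" if "Suc i < n" for i
    using sorted_wrt_nth_less[OF sa, of i "Suc i"] sorted_wrt_nth_less[OF sb, of i "Suc i"]
      that len fa(1) fb(1) by simp_all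
  \<comment> \<open>First summation by parts, over the frame of \<open>a\<close>. The comparison
    sequence is the indicator of \<open>i < min l k\<close>, whose partial sums are the bounds in
    \<open>stu\<close>.\<close>
  have atu: "inner a (t l \<odot> u) \<le> (\<Sum>i<min l k. \<bar>xs ! i\<bar>)" if l: "l \<le> n" for l
  proof -
    have "inner a (t l \<odot> u) = (\<Sum>i<n. \<bar>xs ! i\<bar> * (sgn (xs ! i) * inner (es ! i) (t l \<odot> u)))"
      by (subst fa(2)) (simp add: len inner_sum_left mult.assoc[symmetric] abs_mult_sgn)
    also have "\<dots> \<le> (\<Sum>i<n. \<bar>xs ! i\<bar> * of_bool (i < min l k))"
    proof (rule weighted_sum_mono)
      fix j assume "j \<le> n"
      have "(\<Sum>i<j. sgn (xs ! i) * inner (es ! i) (t l \<odot> u)) = inner (s j) (t l \<odot> u)"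
        by (simp add: s_def inner_sum_left)
      also have "\<dots> \<le> real (min j (min l k))" using stu \<open>j \<le> n\<close> l by blast
      also have "\<dots> = (\<Sum>i<j. of_bool (i < min l k))"
        by (simp add: of_bool_def sum.If_cases lessThan_def[symmetric] Int_def
            flip: min_less_iff_conj)
      finally show "(\<Sum>i<j. sgn (xs ! i) * inner (es ! i) (t l \<odot> u)) \<le> (\<Sum>i<j. of_bool (i < min l k))" .
    qed (use decr in auto)
    also have "\<dots> = (\<Sum>i<min l k. \<bar>xs ! i\<bar>)"
      using l k by (intro sum.mono_neutral_cong_right) auto
    finally show ?thesis .
  qed
  have "(\<Sum>i<k. \<bar>zs ! i\<bar>) = inner (a \<odot> b) u"
  proof -
    have "inner (a \<odot> b) (gs ! i) = zs ! i" if "i < k" for i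
      using spectral_decomposition_eigen[OF z, of i] frame_inner_unit[OF z, of i] that k len
        inner_unit[of "a \<odot> b" "gs ! i"] by simp
    then show ?thesis
      by (simp add: u_def inner_sum_right abs_sgn mult.commute)
  qed
  also have "\<dots> = inner b (a \<odot> u)" by (rule inner_assoc)
  also have "\<dots> = (\<Sum>m<n. \<bar>ys ! m\<bar> * (sgn (ys ! m) * inner (fs ! m) (a \<odot> u)))"
    by (subst fb(2)) (simp add: len inner_sum_left mult.assoc[symmetric] abs_mult_sgn)
  \<comment> \<open>Second summation by parts, over the frame of \<open>b\<close>; the partial sums
    of the new comparison sequence are the bounds in \<open>atu\<close>.\<close>
  also have "\<dots> \<le> (\<Sum>m<n. \<bar>ys ! m\<bar> * (of_bool (m < k) * \<bar>xs ! m\<bar>))"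
  proof (rule weighted_sum_mono)
    fix l assume l: "l \<le> n"
    have "(\<Sum>m<l. sgn (ys ! m) * inner (fs ! m) (a \<odot> u)) = inner (t l) (a \<odot> u)"
      by (simp add: t_def inner_sum_left)
    also have "\<dots> = inner a (t l \<odot> u)" by (metis commute inner_jprod_swap)
    also have "\<dots> \<le> (\<Sum>i<min l k. \<bar>xs ! i\<bar>)" by (rule atu[OF l])
    also have "\<dots> = (\<Sum>m<l. of_bool (m < k) * \<bar>xs ! m\<bar>)"
      by (intro sum.mono_neutral_cong_left) auto
    finally show "(\<Sum>m<l. sgn (ys ! m) * inner (fs ! m) (a \<odot> u))
        \<le> (\<Sum>m<l. of_bool (m < k) * \<bar>xs ! m\<bar>)" .
  qed (use decr in auto)
  also have "\<dots> = (\<Sum>i<k. \<bar>xs ! i\<bar> * \<bar>ys ! i\<bar>)"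
    using k by (intro sum.mono_neutral_cong_right) auto
  finally show ?thesis .
qed

end

lemma decreasing_rearrangement_id:
  assumes "sorted_wrt (\<ge>) p"
  shows "decreasing_rearrangement p = p"
proof -
  have "sort p = rev p"
    using assms by (intro properties_for_sort) (simp_all add: sorted_wrt_rev)
  then show ?thesis by (simp add: decreasing_rearrangement_def)
qed

theorem theorem4p1:
  fixes jprod :: "'a::euclidean_space \<Rightarrow> 'a \<Rightarrow> 'a"
    and e a b :: 'a
    and n :: nat
  assumes "euclidean_jordan_algebra jprod e"
    and "\<forall>x y. inner x y = jordan_trace jprod e (jprod x y)"
    and "jordan_rank jprod e = n"
  shows "weakly_majorized n
           (eigenvalues jprod e (jordan_abs jprod e (jprod a b)))
           (componentwise_prod
             (eigenvalues jprod e (jordan_abs jprod e a))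
             (eigenvalues jprod e (jordan_abs jprod e b)))"
proof -
  interpret trace_jordan_algebra jprod e
    using assms(1,2) by (intro trace_jordan_algebra.intro) (simp_all add: trace_jordan_algebra_axioms_def)
  \<comment> \<open>Ordering by absolute value, not by eigenvalue, makes \<open>map abs xs\<close>
    the eigenvalue list of the absolute value of \<open>a\<close>; likewise for \<open>b\<close> and
    the product.\<close>
  obtain es xs where a: "spectral_decomposition jprod e a es xs" "sorted_wrt (\<ge>) (map abs xs)"
    using spectral_decomposition_exists by blast
  obtain fs ys where b: "spectral_decomposition jprod e b fs ys" "sorted_wrt (\<ge>) (map abs ys)"
    using spectral_decomposition_exists by blast
  obtain gs zs where z: "spectral_decomposition jprod e (jprod a b) gs zs" "sorted_wrt (\<ge>) (map abs zs)"
    using spectral_decomposition_exists by blast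
  have len: "length es = n" "length fs = n" "length gs = n"
    using length_eq_jordan_rank a(1) b(1) z(1) assms(3) by blast+
  have len': "length xs = n" "length ys = n" "length zs = n"
    using spectral_decomposition_frame(1) a(1) b(1) z(1) len by metis+
  let ?q = "map2 (*) (map abs xs) (map abs ys)"
  \<comment> \<open>Products of decreasing nonnegative sequences decrease, so rearrangement leaves
    \<open>?q\<close> unchanged.\<close>
  have "sorted_wrt (\<ge>) ?q"
    unfolding sorted_wrt_iff_nth_less
  proof (intro allI impI)
    fix i j assume ij: "i < j" "j < length ?q"
    then have "\<bar>xs ! j\<bar> \<le> \<bar>xs ! i\<bar>" "\<bar>ys ! j\<bar> \<le> \<bar>ys ! i\<bar>"
      using sorted_wrt_nth_less[OF a(2) ij(1)] sorted_wrt_nth_less[OF b(2) ij(1)] len' by simp_all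
    then show "?q ! j \<le> ?q ! i"
      using ij len' by (simp add: mult_mono)
  qed
  then have "decreasing_rearrangement ?q = ?q" by (rule decreasing_rearrangement_id)
  moreover have "decreasing_rearrangement (map abs zs) = map abs zs"
    by (rule decreasing_rearrangement_id[OF z(2)])
  moreover have "(\<Sum>i<k. map abs zs ! i) \<le> (\<Sum>i<k. ?q ! i)" if "k \<le> n" for k
    using sum_abs_eigenvalues_jprod_le[OF a b z(1) len that] that len' by simp
  ultimately show ?thesis
    unfolding eigenvalues_abs[OF a] eigenvalues_abs[OF b] eigenvalues_abs[OF z]
      weakly_majorized_def componentwise_prod_def
    using len' by simp
qed

end
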